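(* Let $M\ge1$, let $\mathcal{J}\subset\mathbb{R}\setminus\{0\}$ be a finite set, let $\lambda_j>0$ for $j\in\mathcal{J}$, and let $\{\mathcal{S}(B),\ B\in\mathcal{B}\}$ be the generalized Skellam random field on $\mathbb{R}^M_+$ with parameters $\{\lambda_j\}_{j\in\mathcal{J}}$. Let $\{\mathcal{Y}_k\}_{k\ge1}$ be independent and identically distributed random variables taking values in $\mathcal{J}$ with $\mathrm{Pr}\{\mathcal{Y}_1=j\}=\lambda_j/\sum_{i\in\mathcal{J}}\lambda_i$, $j\in\mathcal{J}$, and let $\{N(B),\ B\in\mathcal{B}\}$ be a Poisson random field on $\mathbb{R}^M_+$ with parameter $\sum_{j\in\mathcal{J}}\lambda_j$ that is independent of $\{\mathcal{Y}_k\}_{k\ge1}$. Then, for every $B\in\mathcal{B}$ with $|B|<\infty$, $$\mathcal{S}(B)\overset{d}{=}\sum_{k=1}^{N(B)}\mathcal{Y}_k,$$ where $\overset{d}{=}$ denotes equality in distribution.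
   Context: $\mathcal{B}$ is the Borel sigma-algebra of $\mathbb{R}^M_+$ ($\mathbb{R}_+$ the non-negative reals) and $|B|$ is the Lebesgue measure of $B$. A Poisson random field on $\mathbb{R}^M_+$ with parameter $\lambda>0$ is a non-negative integer-valued random measure $\{N(B),\ B\in\mathcal{B}\}$ such that $N(B)$ is Poisson with mean $\lambda|B|$ whenever $|B|<\infty$, and $N(B_1),\dots,N(B_m)$ are independent for any finite collection of disjoint sets $B_1,\dots,B_m\in\mathcal{B}$. The generalized Skellam random field with parameters $\{\lambda_j\}_{j\in\mathcal{J}}$ is $\mathcal{S}(B)=\sum_{j\in\mathcal{J}}jN_j(B)$, where $\{N_j(B),\ B\in\mathcal{B}\}$, $j\in\mathcal{J}$, are independent Poisson random fields on $\mathbb{R}^M_+$ with parameters $\lambda_j$ respectively. *)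

theory Defs
  imports "HOL-Probability.Probability"
begin

definition orthant_borel :: "(real ^ 'm) measure" where
  "orthant_borel = restrict_space borel {x. \<forall>i. 0 \<le> x $ i}"

context prob_space
begin

definition sigma_gen :: "'i set \<Rightarrow> 'c measure \<Rightarrow> ('i \<Rightarrow> 'a \<Rightarrow> 'c) \<Rightarrow> 'a set set" where
  "sigma_gen T K X = sigma_sets (space M) {X t -` A \<inter> space M |t A. t \<in> T \<and> A \<in> sets K}"

definition field_sigma :: "('a \<Rightarrow> (real ^ 'm) measure) \<Rightarrow> 'a set set" where
  "field_sigma N = sigma_gen (sets orthant_borel) borel (\<lambda>B \<omega>. emeasure (N \<omega>) B)"

text \<open>A realisation of a random field is a measure; \<open>N(B)\<close> is \<open>emeasure (N \<omega>) B\<close>, with values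
  in the non-negative integers together with \<open>\<infinity>\<close>, since \<open>N(B)\<close> is infinite when \<open>|B| = \<infinity>\<close>.\<close>

definition integer_valued_random_measure :: "('a \<Rightarrow> (real ^ 'm) measure) \<Rightarrow> bool" where
  "integer_valued_random_measure N \<longleftrightarrow>
     (\<forall>\<omega>\<in>space M. sets (N \<omega>) = sets orthant_borel) \<and>
     (\<forall>B\<in>sets orthant_borel.
        (\<lambda>\<omega>. emeasure (N \<omega>) B) \<in> borel_measurable M \<and>
        (\<forall>\<omega>\<in>space M. emeasure (N \<omega>) B \<in> insert \<infinity> (range of_nat)))"

text \<open>The Poisson law is written out because \<open>poisson_pmf\<close> is specified only for positive rates,
  whereas \<open>|B| = 0\<close> has to be covered; since \<open>0 ^ 0 = 1\<close>, the formula then gives \<open>N(B) = 0\<close>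
  almost surely.\<close>

definition poisson_random_field :: "real \<Rightarrow> ('a \<Rightarrow> (real ^ 'm) measure) \<Rightarrow> bool" where
  "poisson_random_field lam N \<longleftrightarrow>
     0 < lam \<and>
     integer_valued_random_measure N \<and>
     (\<forall>B\<in>sets orthant_borel. emeasure lborel B < \<infinity> \<longrightarrow>
        (\<forall>k::nat. prob {\<omega> \<in> space M. emeasure (N \<omega>) B = of_nat k} =
           (lam * measure lborel B) ^ k / fact k * exp (- (lam * measure lborel B)))) \<and>
     (\<forall>(n::nat) A. A ` {..<n} \<subseteq> sets orthant_borel \<longrightarrow> disjoint_family_on A {..<n} \<longrightarrow>
        indep_vars (\<lambda>_. borel) (\<lambda>i \<omega>. emeasure (N \<omega>) (A i)) {..<n})"

text \<open>Extended reals accommodate sets \<open>B\<close> with \<open>|B| = \<infinity>\<close>; if there both positive and negative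
  infinite terms occur, the sum is \<open>\<infinity>\<close> by the library's convention \<open>\<infinity> + (- \<infinity>) = \<infinity>\<close>. For
  \<open>|B| < \<infinity>\<close> all summands are finite almost surely.\<close>

definition generalized_skellam_field ::
    "real set \<Rightarrow> (real \<Rightarrow> real) \<Rightarrow> ('a \<Rightarrow> (real ^ 'm) set \<Rightarrow> ereal) \<Rightarrow> bool" where
  "generalized_skellam_field J lam S \<longleftrightarrow>
     (\<exists>N :: real \<Rightarrow> 'a \<Rightarrow> (real ^ 'm) measure.
        (\<forall>j\<in>J. poisson_random_field (lam j) (N j)) \<and>
        indep_sets (\<lambda>j. field_sigma (N j)) J \<and>
        (\<forall>\<omega>\<in>space M. \<forall>B\<in>sets orthant_borel.
           S \<omega> B = (\<Sum>j\<in>J. ereal j * enn2ereal (emeasure (N j \<omega>) B))))"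

end

text \<open>\<open>\<Sum>\<^sub>k\<^sub>=\<^sub>1\<^sup>n y k\<close> with \<open>n\<close> an \<open>ennreal\<close> count. For \<open>n = \<infinity>\<close>, which happens with probability zero
  if \<open>n = N(B)\<close> and \<open>|B| < \<infinity>\<close>, the index set is infinite and the value is \<open>0\<close>.\<close>

definition sum_upto_count :: "ennreal \<Rightarrow> (nat \<Rightarrow> real) \<Rightarrow> real" where
  "sum_upto_count n y = (\<Sum>k | 1 \<le> k \<and> of_nat k \<le> n. y k)"

end

theory Submission
  imports Defs
begin

text \<open>
  Both sides are almost surely real, so it suffices to compare characteristic functions and to apply
  Levy's uniqueness theorem. Write \<open>m = |B|\<close> and \<open>\<Lambda> = (\<Sum>j\<in>J. lam j)\<close>.

  The single computation behind both sides is \<open>char_poisson_mixture\<close>: if \<open>K\<close> is Poisson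
  with mean \<open>a\<close> and, on each event \<open>K = n\<close>, the variable \<open>exp (i t X)\<close> averages to \<open>c ^ n\<close>, then
  \<open>E (exp (i t X)) = (\<Sum>n. a ^ n / fact n * exp (- a) * c ^ n) = exp (a * (c - 1))\<close>.
  For \<open>X = j K\<close> the constant \<open>c\<close> is \<open>exp (i t j)\<close> (\<open>char_scaled_poisson_count\<close>); for a sum of
  \<open>K\<close> independent copies of \<open>Y\<close>, independent of \<open>K\<close>, it is the characteristic function
  \<open>\<phi>\<close> of \<open>Y\<close> (\<open>char_compound_poisson\<close>).

  By independence of the fields, the Skellam side has characteristic function
  \<open>\<Prod>j\<in>J. exp (lam j * m * (exp (i t j) - 1))\<close>. The compound side has \<open>exp (\<Lambda> * m * (\<phi> t - 1))\<close>
  with \<open>\<phi> t = (\<Sum>j\<in>J. lam j / \<Lambda> * exp (i t j))\<close>. The two exponents agree, since the weights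
  \<open>lam j / \<Lambda>\<close> sum to \<open>1\<close>.
\<close>

section \<open>Poisson mixtures\<close>

text \<open>Counts live in \<^typ>\<open>ennreal\<close>, as the values of a random measure do. The law is given by its
  point masses, so that \<open>a = 0\<close> is included: the count is then almost surely \<open>0\<close>.\<close>

definition (in prob_space) poisson_count :: "real \<Rightarrow> ('a \<Rightarrow> ennreal) \<Rightarrow> bool" where
  "poisson_count a K \<longleftrightarrow> K \<in> borel_measurable M \<and>
     (\<forall>n::nat. prob {\<omega> \<in> space M. K \<omega> = of_nat n} = a ^ n / fact n * exp (- a))"

lemma (in prob_space) poisson_count_measurable:
  "poisson_count a K \<Longrightarrow> K \<in> borel_measurable M"
  by (simp add: poisson_count_def)

text \<open>The Poisson masses \<open>a ^ n / fact n * exp (- a)\<close> already add up to \<open>1\<close>, so nothing is left for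
  \<open>\<infinity>\<close> or any other value that is not a natural number.\<close>

lemma (in prob_space) AE_poisson_count_finite:
  assumes K: "poisson_count a K"
  shows "AE \<omega> in M. \<omega> \<in> (\<Union>n::nat. {\<omega> \<in> space M. K \<omega> = of_nat n})"
proof -
  note [measurable] = poisson_count_measurable[OF K]
  define A where "A n = {\<omega> \<in> space M. K \<omega> = of_nat n}" for n :: nat
  have A[measurable]: "A n \<in> events" for n
    unfolding A_def by measurable
  have "(\<lambda>n. prob (A n)) sums prob (\<Union>n. A n)"
    by (rule finite_measure_UNION) (auto simp: disjoint_family_on_def A_def)
  moreover have "(\<lambda>n. prob (A n)) sums (exp a * exp (- a))"
  proof -
    have "(\<lambda>n. a ^ n / fact n) sums exp a"
      using exp_converges[of a] by (simp add: divide_inverse mult.commute)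
    then have "(\<lambda>n. a ^ n / fact n * exp (- a)) sums (exp a * exp (- a))"
      by (rule sums_mult2)
    then show ?thesis
      using K by (simp add: poisson_count_def A_def)
  qed
  ultimately have "prob (\<Union>n. A n) = 1"
    using sums_unique2 by (fastforce simp flip: exp_add)
  then show ?thesis
    unfolding A_def[symmetric] by (subst (asm) prob_eq_1) auto
qed

text \<open>Splitting the expectation along the events \<open>K = n\<close>, which cover almost everything, turns it
  into the exponential series of \<open>a * c\<close> multiplied by \<open>exp (- a)\<close>.\<close>

lemma (in prob_space) char_poisson_mixture:
  fixes X :: "'a \<Rightarrow> real"
  assumes K: "poisson_count a K" and X[measurable]: "X \<in> borel_measurable M"
    and cond: "\<And>n::nat. (CLINT \<omega>|M. indicator {\<omega> \<in> space M. K \<omega> = of_nat n} \<omega> *\<^sub>R iexp (t * X \<omega>))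
       = prob {\<omega> \<in> space M. K \<omega> = of_nat n} *\<^sub>R c ^ n"
  shows "char (distr M borel X) t = exp (complex_of_real a * (c - 1))"
proof -
  note [measurable] = poisson_count_measurable[OF K]
  define A where "A n = {\<omega> \<in> space M. K \<omega> = of_nat n}" for n :: nat
  have A[measurable]: "A n \<in> events" for n
    unfolding A_def by measurable
  have int: "integrable M (\<lambda>\<omega>. iexp (t * X \<omega>))"
    by (rule integrable_iexp) auto
  have "char (distr M borel X) t = (CLINT \<omega>|M. iexp (t * X \<omega>))"
    by (simp add: char_def integral_distr)
  also have "\<dots> = (LINT \<omega>:(\<Union>n. A n)|M. iexp (t * X \<omega>))"
    unfolding set_lebesgue_integral_def
    using AE_poisson_count_finite[OF K] unfolding A_def[symmetric]
    by (intro integral_cong_AE) (auto elim!: eventually_mono simp: indicator_def)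
  also have "\<dots> = (\<Sum>n. LINT \<omega>:A n|M. iexp (t * X \<omega>))"
  proof (rule lebesgue_integral_countable_add)
    show "set_integrable M (\<Union>n. A n) (\<lambda>\<omega>. iexp (t * X \<omega>))"
      unfolding set_integrable_def by (rule integrable_mult_indicator[OF _ int]) auto
  qed (auto simp: A_def)
  also have "\<dots> = (\<Sum>n. prob (A n) *\<^sub>R c ^ n)"
    unfolding set_lebesgue_integral_def A_def by (simp only: cond)
  also have "\<dots> = (\<Sum>n. exp (- complex_of_real a) * ((of_real a * c) ^ n /\<^sub>R fact n))"
    using K by (simp add: poisson_count_def A_def scaleR_conv_of_real power_mult_distrib
        divide_inverse ac_simps flip: exp_of_real)
  also have "\<dots> = exp (- complex_of_real a) * exp (of_real a * c)"
    using sums_mult[OF exp_converges] by (rule sums_unique[symmetric])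
  also have "\<dots> = exp (complex_of_real a * (c - 1))"
    by (simp add: algebra_simps flip: exp_add)
  finally show ?thesis .
qed

lemma (in prob_space) integral_indicator_scaleR_const:
  fixes c :: "'b::{banach, second_countable_topology}"
  assumes "A \<in> events"
  shows "(LINT \<omega>|M. indicator A \<omega> *\<^sub>R c) = prob A *\<^sub>R c"
  using assms by (subst integral_scaleR_left) (auto simp: integrable_indicator_iff emeasure_eq_measure)

lemma (in prob_space) char_scaled_poisson_count:
  assumes K: "poisson_count a K"
  shows "char (distr M borel (\<lambda>\<omega>. j * enn2real (K \<omega>))) t
    = exp (complex_of_real a * (iexp (t * j) - 1))"
proof (rule char_poisson_mixture[OF K])
  note [measurable] = poisson_count_measurable[OF K]
  show "(\<lambda>\<omega>. j * enn2real (K \<omega>)) \<in> borel_measurable M"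
    by measurable
  fix n :: nat
  let ?A = "{\<omega> \<in> space M. K \<omega> = of_nat n}"
  have "(CLINT \<omega>|M. indicator ?A \<omega> *\<^sub>R iexp (t * (j * enn2real (K \<omega>))))
      = (CLINT \<omega>|M. indicator ?A \<omega> *\<^sub>R iexp (t * j) ^ n)"
    by (intro Bochner_Integration.integral_cong)
      (auto simp: indicator_def ac_simps simp flip: exp_of_nat_mult)
  also have "\<dots> = prob ?A *\<^sub>R iexp (t * j) ^ n"
    by (rule integral_indicator_scaleR_const) measurable
  finally show "(CLINT \<omega>|M. indicator ?A \<omega> *\<^sub>R iexp (t * (j * enn2real (K \<omega>))))
      = prob ?A *\<^sub>R iexp (t * j) ^ n" .
qed

section \<open>Sums with a Poisson number of terms\<close>

lemma (in prob_space) char_finite_valued: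
  assumes [measurable]: "Z \<in> borel_measurable M" and "finite J"
    and "\<And>\<omega>. \<omega> \<in> space M \<Longrightarrow> Z \<omega> \<in> J"
  shows "char (distr M borel Z) t = (\<Sum>j\<in>J. prob {\<omega> \<in> space M. Z \<omega> = j} *\<^sub>R iexp (t * j))"
proof -
  have "char (distr M borel Z) t = (CLINT \<omega>|M. iexp (t * Z \<omega>))"
    by (simp add: char_def integral_distr)
  also have "\<dots> = (CLINT \<omega>|M. \<Sum>j\<in>J. indicator {\<omega> \<in> space M. Z \<omega> = j} \<omega> *\<^sub>R iexp (t * j))"
    using assms(2,3)
    by (intro Bochner_Integration.integral_cong)
       (auto simp: indicator_def of_bool_def if_distrib[of "\<lambda>x. x *\<^sub>R _"] sum.delta cong: if_cong)
  also have "\<dots> = (\<Sum>j\<in>J. CLINT \<omega>|M. indicator {\<omega> \<in> space M. Z \<omega> = j} \<omega> *\<^sub>R iexp (t * j))"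
    by (intro Bochner_Integration.integral_sum integrable_scaleR_left impI)
       (auto simp: integrable_indicator_iff emeasure_eq_measure)
  also have "\<dots> = (\<Sum>j\<in>J. prob {\<omega> \<in> space M. Z \<omega> = j} *\<^sub>R iexp (t * j))"
    by (intro sum.cong refl integral_indicator_scaleR_const) measurable
  finally show ?thesis .
qed

lemma sum_upto_count_of_nat: "sum_upto_count (of_nat n) y = (\<Sum>k=1..n. y k)"
  unfolding sum_upto_count_def by (rule sum.cong) auto

lemma sum_upto_count_top: "sum_upto_count \<infinity> y = 0"
proof -
  have "{k::nat. 1 \<le> k \<and> of_nat k \<le> (\<infinity>::ennreal)} = {1..}"
    by auto
  then show ?thesis
    unfolding sum_upto_count_def by (simp add: infinite_Ici)
qed

lemma borel_measurable_sum_upto_count: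
  assumes [measurable]: "K \<in> borel_measurable M"
    and K: "\<And>\<omega>. \<omega> \<in> space M \<Longrightarrow> K \<omega> \<in> insert \<infinity> (range of_nat)"
    and Y: "\<And>k. 1 \<le> k \<Longrightarrow> Y k \<in> borel_measurable M"
  shows "(\<lambda>\<omega>. sum_upto_count (K \<omega>) (\<lambda>k. Y k \<omega>)) \<in> borel_measurable M"
proof -
  have [measurable]: "(\<lambda>\<omega>. \<Sum>k=1..n. Y k \<omega>) \<in> borel_measurable M" for n
    using Y by auto
  (* A finite count is recovered as a natural number by rounding its real value, which turns the
     random upper limit of the sum into a countably-valued measurable index. *)
  have "(\<lambda>\<omega>. if K \<omega> = \<infinity> then 0 else \<Sum>k=1..nat \<lfloor>enn2real (K \<omega>)\<rfloor>. Y k \<omega>) \<in> borel_measurable M"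
    by (rule measurable_compose_countable
        [where f = "\<lambda>n \<omega>. if K \<omega> = \<infinity> then 0 else \<Sum>k=1..n. Y k \<omega>"]) measurable
  also have "?this \<longleftrightarrow> ?thesis"
  proof (rule measurable_cong)
    fix \<omega> assume "\<omega> \<in> space M"
    from K[OF this] show "(if K \<omega> = \<infinity> then 0 else \<Sum>k=1..nat \<lfloor>enn2real (K \<omega>)\<rfloor>. Y k \<omega>)
        = sum_upto_count (K \<omega>) (\<lambda>k. Y k \<omega>)"
      by (auto simp: sum_upto_count_top[simplified] sum_upto_count_of_nat[simplified])
  qed
  finally show ?thesis .
qed

text \<open>Each \<open>Y k\<close> is measurable for the \<open>\<sigma>\<close>-algebra that the whole sequence generates, hence so are
  the partial sums. Thus independence of that \<open>\<sigma>\<close>-algebra passes to the partial sums.\<close>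

lemma (in prob_space) sigma_sets_sum_subset_sigma_gen:
  fixes Y :: "nat \<Rightarrow> 'a \<Rightarrow> real"
  shows "sigma_sets (space M) {(\<lambda>\<omega>. \<Sum>k=1..n. Y k \<omega>) -` A \<inter> space M |A. A \<in> sets borel}
    \<subseteq> sigma_gen {1..} borel Y"
proof -
  define \<G> where "\<G> = {Y k -` A \<inter> space M |k A. k \<in> {1..} \<and> A \<in> sets borel}"
  have \<G>: "\<G> \<subseteq> Pow (space M)"
    by (auto simp: \<G>_def)
  have "Y k \<in> borel_measurable (sigma (space M) \<G>)" if "1 \<le> k" for k
  proof (rule measurableI)
    fix A :: "real set" assume "A \<in> sets borel"
    then have "Y k -` A \<inter> space M \<in> \<G>"
      using that by (auto simp: \<G>_def)
    then show "Y k -` A \<inter> space (sigma (space M) \<G>) \<in> sets (sigma (space M) \<G>)"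
      using \<G> by (simp add: sigma_sets.Basic)
  qed simp
  then have "(\<lambda>\<omega>. \<Sum>k=1..n. Y k \<omega>) \<in> borel_measurable (sigma (space M) \<G>)"
    by auto
  from measurable_sets[OF this] have
    "{(\<lambda>\<omega>. \<Sum>k=1..n. Y k \<omega>) -` A \<inter> space M |A. A \<in> sets borel} \<subseteq> sigma_sets (space M) \<G>"
    using \<G> by auto
  then show ?thesis
    unfolding sigma_gen_def \<G>_def by (rule sigma_sets_mono)
qed

text \<open>On \<open>K = n\<close> the random sum is the partial sum \<open>Y 1 + \<dots> + Y n\<close>. It is independent of that
  event, and its characteristic function is the \<open>n\<close>-th power of \<open>c\<close>, so that the Poisson mixture
  formula applies.\<close>

lemma (in prob_space) char_compound_poisson:
  assumes K: "poisson_count a K"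
    and K_range: "\<And>\<omega>. \<omega> \<in> space M \<Longrightarrow> K \<omega> \<in> insert \<infinity> (range of_nat)"
    and Y: "indep_vars (\<lambda>_. borel) Y {1..}"
    and c: "\<And>k. 1 \<le> k \<Longrightarrow> char (distr M borel (Y k)) t = c"
    and KY: "indep_set (sigma_sets (space M) {K -` A \<inter> space M |A. A \<in> sets borel})
           (sigma_gen {1..} borel Y)"
  shows "char (distr M borel (\<lambda>\<omega>. sum_upto_count (K \<omega>) (\<lambda>k. Y k \<omega>))) t
    = exp (complex_of_real a * (c - 1))"
proof (rule char_poisson_mixture[OF K])
  note [measurable] = poisson_count_measurable[OF K]
  have Y_meas: "1 \<le> k \<Longrightarrow> Y k \<in> borel_measurable M" for k
    using Y by (simp add: indep_vars_def)
  show "(\<lambda>\<omega>. sum_upto_count (K \<omega>) (\<lambda>k. Y k \<omega>)) \<in> borel_measurable M"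
    using K_range Y_meas by (intro borel_measurable_sum_upto_count) auto
  fix n :: nat
  let ?A = "{\<omega> \<in> space M. K \<omega> = of_nat n}"
  let ?T = "\<lambda>\<omega>. \<Sum>k=1..n. Y k \<omega>"
  have [measurable]: "?T \<in> borel_measurable M"
    using Y_meas by auto
  have "(CLINT \<omega>|M. indicator ?A \<omega> *\<^sub>R iexp (t * sum_upto_count (K \<omega>) (\<lambda>k. Y k \<omega>)))
      = (CLINT \<omega>|M. complex_of_real (indicator {of_nat n} (K \<omega>)) * iexp (t * ?T \<omega>))"
    by (intro Bochner_Integration.integral_cong)
      (auto simp: indicator_def sum_upto_count_of_nat[simplified])
  also have "\<dots> = (CLINT \<omega>|M. complex_of_real (indicator {of_nat n} (K \<omega>))) * (CLINT \<omega>|M. iexp (t * ?T \<omega>))"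
  proof (rule indep_var_lebesgue_integral)
    (* indep_var relates two variables of the same type, so the event K = n enters through its
       real-valued indicator and not through K itself. *)
    have "(\<lambda>\<omega>. indicator {of_nat n} (K \<omega>) :: real) -` A \<inter> space M
        = K -` ((indicator {of_nat n} :: ennreal \<Rightarrow> real) -` A) \<inter> space M" for A
      by auto
    moreover have "(indicator {of_nat n} :: ennreal \<Rightarrow> real) -` A \<in> sets borel"
      if "A \<in> sets borel" for A
      using measurable_sets[OF borel_measurable_indicator[of "{of_nat n :: ennreal}" borel] that] by simp
    ultimately have "sigma_sets (space M)
        {(\<lambda>\<omega>. indicator {of_nat n} (K \<omega>) :: real) -` A \<inter> space M |A. A \<in> sets borel}
        \<subseteq> sigma_sets (space M) {K -` A \<inter> space M |A. A \<in> sets borel}"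
      by (intro sigma_sets_mono') blast
    then have "indep_set
        (sigma_sets (space M)
          {(\<lambda>\<omega>. indicator {of_nat n} (K \<omega>) :: real) -` A \<inter> space M |A. A \<in> sets borel})
        (sigma_sets (space M) {?T -` A \<inter> space M |A. A \<in> sets borel})"
      using KY sigma_sets_sum_subset_sigma_gen[where Y = Y and n = n]
      unfolding indep_sets2_eq by blast
    then have "indep_var borel (\<lambda>\<omega>. indicator {of_nat n} (K \<omega>) :: real) borel ?T"
      unfolding indep_var_eq using Y_meas by auto
    from indep_var_compose[OF this, of complex_of_real borel "\<lambda>x. iexp (t * x)" borel]
    show "indep_var borel (\<lambda>\<omega>. complex_of_real (indicator {of_nat n} (K \<omega>)))
        borel (\<lambda>\<omega>. iexp (t * ?T \<omega>))"
      by (simp add: comp_def)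
    show "integrable M (\<lambda>\<omega>. complex_of_real (indicator {of_nat n} (K \<omega>)))"
      by (rule integrable_const_bound[where B = 1]) (auto simp: indicator_def)
    show "integrable M (\<lambda>\<omega>. iexp (t * ?T \<omega>))"
      using Y_meas by (intro integrable_iexp) auto
  qed
  also have "(CLINT \<omega>|M. complex_of_real (indicator {of_nat n} (K \<omega>))) = prob ?A"
  proof -
    have "(LINT \<omega>|M. indicator {of_nat n} (K \<omega>) :: real) = (LINT \<omega>|M. indicator ?A \<omega>)"
      by (intro Bochner_Integration.integral_cong) (auto simp: indicator_def)
    then show ?thesis
      by simp
  qed
  also have "(CLINT \<omega>|M. iexp (t * ?T \<omega>)) = char (distr M borel ?T) t"
    using Y_meas by (simp add: char_def integral_distr)
  also have "\<dots> = (\<Prod>k=1..n. char (distr M borel (Y k)) t)"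
    by (rule char_distr_sum, rule indep_vars_subset[OF Y]) auto
  also have "\<dots> = c ^ n"
    using c by simp
  finally show "(CLINT \<omega>|M. indicator ?A \<omega> *\<^sub>R iexp (t * sum_upto_count (K \<omega>) (\<lambda>k. Y k \<omega>)))
      = prob ?A *\<^sub>R c ^ n"
    by (simp add: scaleR_conv_of_real)
qed

section \<open>Random fields evaluated at a set\<close>

lemma (in prob_space) poisson_count_field:
  assumes "poisson_random_field lam N" "B \<in> sets orthant_borel" "emeasure lborel B < \<infinity>"
  shows "poisson_count (lam * measure lborel B) (\<lambda>\<omega>. emeasure (N \<omega>) B)"
  using assms unfolding poisson_random_field_def integer_valued_random_measure_def poisson_count_def
  by blast

lemma (in prob_space) sigma_sets_emeasure_subset_field_sigma:
  assumes "B \<in> sets orthant_borel"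
  shows "sigma_sets (space M) {(\<lambda>\<omega>. emeasure (N \<omega>) B) -` A \<inter> space M |A. A \<in> sets borel}
    \<subseteq> field_sigma N"
  unfolding field_sigma_def sigma_gen_def using assms by (intro sigma_sets_mono') auto

section \<open>The Skellam field as a compound Poisson sum\<close>

theorem proposition3p1:
  fixes P :: "'a measure" and Q :: "'b measure"
    and J :: "real set" and lam :: "real \<Rightarrow> real"
    and S :: "'a \<Rightarrow> (real ^ 'm) set \<Rightarrow> ereal"
    and Y :: "nat \<Rightarrow> 'b \<Rightarrow> real"
    and N :: "'b \<Rightarrow> (real ^ 'm) measure"
    and B :: "(real ^ 'm) set"
  assumes "prob_space P" and "prob_space Q"
    and "finite J" and "0 \<notin> J"
    and "\<And>j. j \<in> J \<Longrightarrow> 0 < lam j"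
    and "prob_space.generalized_skellam_field P J lam S"
    and "prob_space.indep_vars Q (\<lambda>_. borel) Y {1..}"
    and "\<And>k. 1 \<le> k \<Longrightarrow> distr Q borel (Y k) = distr Q borel (Y 1)"
    and "\<And>k \<omega>. 1 \<le> k \<Longrightarrow> \<omega> \<in> space Q \<Longrightarrow> Y k \<omega> \<in> J"
    and "\<And>j. j \<in> J \<Longrightarrow> measure Q {\<omega> \<in> space Q. Y 1 \<omega> = j} = lam j / (\<Sum>i\<in>J. lam i)"
    and "prob_space.poisson_random_field Q (\<Sum>j\<in>J. lam j) N"
    and "prob_space.indep_set Q (prob_space.field_sigma Q N) (prob_space.sigma_gen Q {1..} borel Y)"
    and "B \<in> sets orthant_borel" and "emeasure lborel B < \<infinity>"
  shows "distr P borel (\<lambda>\<omega>. S \<omega> B) =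
         distr Q borel (\<lambda>\<omega>. ereal (sum_upto_count (emeasure (N \<omega>) B) (\<lambda>k. Y k \<omega>)))"
proof -
  interpret P: prob_space P by fact
  interpret Q: prob_space Q by fact
  note B = assms(13,14)
  let ?m = "measure lborel B"
  let ?L = "\<Sum>j\<in>J. lam j"
  (* Positivity of the total rate excludes an empty J. *)
  have L: "0 < ?L"
    using assms(11) by (simp add: Q.poisson_random_field_def)
  obtain NP :: "real \<Rightarrow> 'a \<Rightarrow> (real ^ 'm) measure"
    where NP: "\<And>j. j \<in> J \<Longrightarrow> P.poisson_random_field (lam j) (NP j)"
      and NP_indep: "P.indep_sets (\<lambda>j. P.field_sigma (NP j)) J"
      and S: "\<And>\<omega>. \<omega> \<in> space P \<Longrightarrow>
        S \<omega> B = (\<Sum>j\<in>J. ereal j * enn2ereal (emeasure (NP j \<omega>) B))"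
    using assms(6) B(1) unfolding P.generalized_skellam_field_def by blast
  (* U and V are real-valued versions of the two sides. U agrees with S(B) only almost surely,
     because enn2real sends an infinite count to 0. *)
  define KP where "KP j \<omega> = emeasure (NP j \<omega>) B" for j \<omega>
  define K where "K \<omega> = emeasure (N \<omega>) B" for \<omega>
  define U where "U \<omega> = (\<Sum>j\<in>J. j * enn2real (KP j \<omega>))" for \<omega>
  define V where "V \<omega> = sum_upto_count (K \<omega>) (\<lambda>k. Y k \<omega>)" for \<omega>

  have KP: "P.poisson_count (lam j * ?m) (KP j)" if "j \<in> J" for j
    using P.poisson_count_field[OF NP[OF that] B] by (simp add: KP_def[abs_def])
  have K: "Q.poisson_count (?L * ?m) K"
    using Q.poisson_count_field[OF assms(11) B] by (simp add: K_def[abs_def])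
  have K_range: "K \<omega> \<in> insert \<infinity> (range of_nat)" if "\<omega> \<in> space Q" for \<omega>
    using assms(11) B(1) that
    unfolding Q.poisson_random_field_def Q.integer_valued_random_measure_def K_def by blast
  have KP_meas[measurable]: "KP j \<in> borel_measurable P" if "j \<in> J" for j
    using P.poisson_count_measurable[OF KP[OF that]] .
  have Y_meas: "Y k \<in> borel_measurable Q" if "1 \<le> k" for k
    using assms(7) that by (simp add: Q.indep_vars_def)
  have U_meas[measurable]: "U \<in> borel_measurable P"
    unfolding U_def by measurable
  have V_meas[measurable]: "V \<in> borel_measurable Q"
    unfolding V_def using Q.poisson_count_measurable[OF K] K_range Y_meas
    by (rule borel_measurable_sum_upto_count)

  have char_U: "char (distr P borel U) t
      = exp (\<Sum>j\<in>J. complex_of_real (lam j * ?m) * (iexp (t * j) - 1))" for t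
  proof -
    have "P.indep_vars (\<lambda>_. borel) KP J"
      unfolding P.indep_vars_def
      using NP_indep P.sigma_sets_emeasure_subset_field_sigma[OF B(1)] KP_meas
      by (auto simp: KP_def[abs_def] intro: P.indep_sets_mono_sets)
    then have "P.indep_vars (\<lambda>_. borel) (\<lambda>j \<omega>. j * enn2real (KP j \<omega>)) J"
      by (rule P.indep_vars_compose2) measurable
    then have "char (distr P borel U) t
        = (\<Prod>j\<in>J. char (distr P borel (\<lambda>\<omega>. j * enn2real (KP j \<omega>))) t)"
      unfolding U_def by (rule P.char_distr_sum)
    also have "\<dots> = (\<Prod>j\<in>J. exp (complex_of_real (lam j * ?m) * (iexp (t * j) - 1)))"
      by (intro prod.cong refl P.char_scaled_poisson_count KP)
    finally show ?thesis
      by (simp add: exp_sum assms(3))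
  qed

  have char_V: "char (distr Q borel V) t
      = exp (complex_of_real (?L * ?m) * ((\<Sum>j\<in>J. (lam j / ?L) *\<^sub>R iexp (t * j)) - 1))" for t
    unfolding V_def
  proof (rule Q.char_compound_poisson[OF K K_range assms(7)])
    fix k :: nat assume k: "1 \<le> k"
    have "char (distr Q borel (Y k)) t = char (distr Q borel (Y 1)) t"
      by (subst assms(8)[OF k]) simp
    also have "\<dots> = (\<Sum>j\<in>J. Q.prob {\<omega> \<in> space Q. Y 1 \<omega> = j} *\<^sub>R iexp (t * j))"
      using Y_meas assms(3,9) by (intro Q.char_finite_valued) auto
    also have "\<dots> = (\<Sum>j\<in>J. (lam j / ?L) *\<^sub>R iexp (t * j))"
      by (intro sum.cong refl) (simp only: assms(10))
    finally show "char (distr Q borel (Y k)) t = (\<Sum>j\<in>J. (lam j / ?L) *\<^sub>R iexp (t * j))" .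
  next
    show "Q.indep_set (sigma_sets (space Q) {K -` A \<inter> space Q |A. A \<in> sets borel})
        (Q.sigma_gen {1..} borel Y)"
      using assms(12) Q.sigma_sets_emeasure_subset_field_sigma[OF B(1), of N]
      unfolding Q.indep_sets2_eq K_def[abs_def] by blast
  qed

  have "distr P borel U = distr Q borel V"
  proof (rule Levy_uniqueness)
    show "char (distr P borel U) = char (distr Q borel V)"
    proof
      fix t
      have "(\<Sum>j\<in>J. complex_of_real (lam j * ?m) * (iexp (t * j) - 1))
          = of_real ?m * ((\<Sum>j\<in>J. of_real (lam j) * iexp (t * j)) - of_real ?L)"
        by (simp add: sum_distrib_left sum_subtractf algebra_simps)
      also have "(\<Sum>j\<in>J. of_real (lam j) * iexp (t * j))
          = of_real ?L * (\<Sum>j\<in>J. (lam j / ?L) *\<^sub>R iexp (t * j))"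
        unfolding sum_distrib_left using L
        by (intro sum.cong refl) (simp add: scaleR_conv_of_real flip: of_real_sum)
      finally have exponent: "(\<Sum>j\<in>J. complex_of_real (lam j * ?m) * (iexp (t * j) - 1))
          = of_real ?m * (of_real ?L * (\<Sum>j\<in>J. (lam j / ?L) *\<^sub>R iexp (t * j)) - of_real ?L)" .
      show "char (distr P borel U) t = char (distr Q borel V) t"
        unfolding char_U char_V exponent by (simp add: algebra_simps del: of_real_sum)
    qed
  qed (auto intro: P.real_distribution_distr Q.real_distribution_distr)
  then have UV: "distr (distr P borel U) borel ereal = distr (distr Q borel V) borel ereal"
    by simp

  have "distr P borel (\<lambda>\<omega>. S \<omega> B) = distr P borel (\<lambda>\<omega>. \<Sum>j\<in>J. ereal j * enn2ereal (KP j \<omega>))"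
    by (rule distr_cong) (auto simp: S KP_def)
  also have "\<dots> = distr P borel (\<lambda>\<omega>. ereal (U \<omega>))"
  proof (rule distr_cong_AE)
    have "AE \<omega> in P. \<forall>j\<in>J. \<omega> \<in> (\<Union>n::nat. {\<omega> \<in> space P. KP j \<omega> = of_nat n})"
      using assms(3) by (intro AE_finite_allI P.AE_poisson_count_finite[OF KP])
    then show "AE \<omega> in P. (\<Sum>j\<in>J. ereal j * enn2ereal (KP j \<omega>)) = ereal (U \<omega>)"
    proof eventually_elim
      case (elim \<omega>)
      have "ereal j * enn2ereal (KP j \<omega>) = ereal (j * enn2real (KP j \<omega>))" if j: "j \<in> J" for j
      proof -
        from elim j obtain n :: nat where "KP j \<omega> = of_nat n"
          by blast
        then have "KP j \<omega> = ennreal (real n)"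
          by (simp add: ennreal_of_nat_eq_real_of_nat)
        then show ?thesis
          by (simp add: enn2ereal_ennreal)
      qed
      then show ?case
        by (simp add: U_def)
    qed
  qed auto
  also have "\<dots> = distr (distr P borel U) borel ereal"
    by (simp add: distr_distr comp_def)
  also have "\<dots> = distr Q borel (\<lambda>\<omega>. ereal (V \<omega>))"
    unfolding UV by (simp add: distr_distr comp_def)
  finally show ?thesis
    by (simp add: V_def K_def)
qed

end
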